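(* Let $(\mathcal{A},\mu,\alpha)$ and $(\mathcal{A}',\mu',\alpha')$ be multiplicative Hom-associative algebras over $\mathbb{K}$, $\phi:\mathcal{A}\to\mathcal{A}'$ a Hom-associative algebra morphism, and $M=\mathcal{A}'$ regarded as an $\mathcal{A}$-bimodule via $\phi$. Then the operators $\delta^n_{Hom}:C^n_{\alpha,\alpha'}(\mathcal{A},M)\to C^{n+1}_{\alpha,\alpha'}(\mathcal{A},M)$ satisfy $\delta^{n+1}_{Hom}\circ\delta^n_{Hom}=0$ for all $n\ge1$.
   Context: $\mathbb{K}$ is an algebraically closed field of characteristic $0$. A Hom-associative algebra $(\mathcal{A},\mu,\alpha)$ is a vector space with a bilinear map $\mu$ and a linear map $\alpha$ such that $\mu(\alpha(x),\mu(y,z))=\mu(\mu(x,y),\alpha(z))$; it is multiplicative if $\alpha\circ\mu=\mu\circ(\alpha\otimes\alpha)$. A morphism $\phi$ is a linear map with $\mu'\circ(\phi\otimes\phi)=\phi\circ\mu$ and $\phi\circ\alpha=\alpha'\circ\phi$. The $\mathcal{A}$-bimodule structure on $M=\mathcal{A}'$ is given by $\rho_l(a,a')=\mu'(\phi(a),a')$, $\rho_r(a',a)=\mu'(a',\phi(a))$ and the twisting map $\alpha'$. $C^n_{\alpha,\alpha'}(\mathcal{A},M)$ is the space of $n$-linear maps $f:\mathcal{A}^{\times n}\to M$ with $\alpha'(f(u_1,\dots,u_n))=f(\alpha(u_1),\dots,\alpha(u_n))$. For $n\ge1$, $$\delta^n_{Hom}\varphi(x_0,\dots,x_n)=\mu'(\phi(\alpha^{n-1}(x_0)),\varphi(x_1,\dots,x_n))+\sum_{k=1}^n(-1)^k\varphi(\alpha(x_0),\dots,\alpha(x_{k-2}),\mu(x_{k-1},x_k),\alpha(x_{k+1}),\dots,\alpha(x_n))+(-1)^{n+1}\mu'(\varphi(x_0,\dots,x_{n-1}),\phi(\alpha^{n-1}(x_n))).$$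 *)

theory Defs
  imports
    "HOL-Library.FuncSet"
    "HOL-Computational_Algebra.Fundamental_Theorem_Algebra"
begin

text \<open>
  A vector space over a field is given by a type together with its scalar multiplication
  (locale \<^locale>\<open>vector_space\<close>), so every linear structure below carries its scalar
  multiplication explicitly.
\<close>

locale hom_associative_algebra = vector_space scale
  for scale :: "'k::field \<Rightarrow> 'a::ab_group_add \<Rightarrow> 'a" +
  fixes mu :: "'a \<Rightarrow> 'a \<Rightarrow> 'a"
    and alpha :: "'a \<Rightarrow> 'a"
  assumes mu_linear_left: "Vector_Spaces.linear scale scale (\<lambda>x. mu x y)"
    and mu_linear_right: "Vector_Spaces.linear scale scale (\<lambda>y. mu x y)"
    and alpha_linear: "Vector_Spaces.linear scale scale alpha"
    and hom_associative: "mu (alpha x) (mu y z) = mu (mu x y) (alpha z)"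

locale multiplicative_hom_associative_algebra = hom_associative_algebra +
  assumes multiplicative: "alpha (mu x y) = mu (alpha x) (alpha y)"

locale hom_associative_morphism =
  A: hom_associative_algebra scale mu alpha +
  A': hom_associative_algebra scale' mu' alpha'
  for scale :: "'k::field \<Rightarrow> 'a::ab_group_add \<Rightarrow> 'a"
    and mu :: "'a \<Rightarrow> 'a \<Rightarrow> 'a"
    and alpha :: "'a \<Rightarrow> 'a"
    and scale' :: "'k \<Rightarrow> 'b::ab_group_add \<Rightarrow> 'b"
    and mu' :: "'b \<Rightarrow> 'b \<Rightarrow> 'b"
    and alpha' :: "'b \<Rightarrow> 'b" +
  fixes phi :: "'a \<Rightarrow> 'b"
  assumes phi_linear: "Vector_Spaces.linear scale scale' phi"
    and phi_mu: "mu' (phi x) (phi y) = phi (mu x y)"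
    and phi_alpha: "phi (alpha x) = alpha' (phi x)"

definition left_action :: "('b \<Rightarrow> 'b \<Rightarrow> 'b) \<Rightarrow> ('a \<Rightarrow> 'b) \<Rightarrow> 'a \<Rightarrow> 'b \<Rightarrow> 'b" where
  "left_action mu' phi a m = mu' (phi a) m"

definition right_action :: "('b \<Rightarrow> 'b \<Rightarrow> 'b) \<Rightarrow> ('a \<Rightarrow> 'b) \<Rightarrow> 'b \<Rightarrow> 'a \<Rightarrow> 'b" where
  "right_action mu' phi m a = mu' m (phi a)"

text \<open>
  A map in n variables is a function on lists, of which only the values on lists of length n
  matter; elsewhere it is required to be 0, so that distinct functions are distinct n-linear maps.
\<close>

definition multilinear_maps ::
  "('k::field \<Rightarrow> 'a::ab_group_add \<Rightarrow> 'a) \<Rightarrow> ('k \<Rightarrow> 'b::ab_group_add \<Rightarrow> 'b) \<Rightarrow> nat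
    \<Rightarrow> ('a list \<Rightarrow> 'b) set" where
  "multilinear_maps scale scale' n =
    {f. (\<forall>us i. length us = n \<longrightarrow> i < n \<longrightarrow>
            Vector_Spaces.linear scale scale' (\<lambda>u. f (us[i := u]))) \<and>
        (\<forall>us. length us \<noteq> n \<longrightarrow> f us = 0)}"

definition hom_cochains ::
  "('k::field \<Rightarrow> 'a::ab_group_add \<Rightarrow> 'a) \<Rightarrow> ('a \<Rightarrow> 'a)
    \<Rightarrow> ('k \<Rightarrow> 'b::ab_group_add \<Rightarrow> 'b) \<Rightarrow> ('b \<Rightarrow> 'b) \<Rightarrow> nat \<Rightarrow> ('a list \<Rightarrow> 'b) set" where
  "hom_cochains scale alpha scale' alpha' n =
    {f \<in> multilinear_maps scale scale' n.
      \<forall>us. length us = n \<longrightarrow> alpha' (f us) = f (map alpha us)}"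

text \<open>
  The list \<open>xs\<close> is \<open>x\<^sub>0, ..., x\<^sub>n\<close>. The definition is meant for \<open>n \<ge> 1\<close> only, as
  the exponent \<open>n - 1\<close> is truncated at 0.
\<close>

definition hom_coboundary ::
  "('a \<Rightarrow> 'a \<Rightarrow> 'a) \<Rightarrow> ('a \<Rightarrow> 'a)
    \<Rightarrow> ('k::field \<Rightarrow> 'b::ab_group_add \<Rightarrow> 'b) \<Rightarrow> ('b \<Rightarrow> 'b \<Rightarrow> 'b) \<Rightarrow> ('a \<Rightarrow> 'b)
    \<Rightarrow> nat \<Rightarrow> ('a list \<Rightarrow> 'b) \<Rightarrow> 'a list \<Rightarrow> 'b" where
  "hom_coboundary mu alpha scale' mu' phi n f xs =
    (if length xs = n + 1 then
       left_action mu' phi ((alpha ^^ (n - 1)) (xs ! 0)) (f (drop 1 xs))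
       + (\<Sum>k = 1..n. scale' ((- 1) ^ k)
            (f (map alpha (take (k - 1) xs) @ [mu (xs ! (k - 1)) (xs ! k)]
                @ map alpha (drop (k + 1) xs))))
       + scale' ((- 1) ^ (n + 1))
            (right_action mu' phi (f (take n xs)) ((alpha ^^ (n - 1)) (xs ! n)))
     else 0)"

end

theory Submission
  imports Defs
begin

text \<open>
  The operator \<open>\<delta>\<^sup>n\<close> is an alternating sum of coface maps \<open>d\<^sub>0, ..., d\<^sub>n\<^sub>+\<^sub>1\<close>: the left action,
  the \<open>n\<close> contractions of neighbouring arguments, and the right action. These satisfy the
  cosimplicial identities \<open>d\<^sub>j d\<^sub>i = d\<^sub>i d\<^sub>j\<^sub>-\<^sub>1\<close> for \<open>i < j\<close>, so the terms of the double sum cancel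
  in pairs. For \<open>j = i + 1\<close> the identity is Hom-associativity of \<open>\<mu>\<close> (or of \<open>\<mu>'\<close> at the two
  ends); for contractions further apart it is multiplicativity of \<open>\<alpha>\<close>. At the ends one also uses
  that the cochain commutes with the twisting maps.
\<close>

section \<open>Cancellation in alternating double sums\<close>

lemma (in vector_space) sum_alternating_cancel:
  assumes "\<And>i j. i \<le> j \<Longrightarrow> j \<le> N \<Longrightarrow> g (Suc j) i = g i j"
  shows "(\<Sum>j\<le>Suc N. \<Sum>i\<le>N. scale ((- 1) ^ (j + i)) (g j i)) = 0"
proof -
  define h where "h = (\<lambda>(j, i). scale ((- 1) ^ (j + i)) (g j i))"
  define L where "L = {(j, i). j \<le> Suc N \<and> i \<le> N \<and> i < j}"
  define U where "U = {(j, i). j \<le> Suc N \<and> i \<le> N \<and> j \<le> i}"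
  have fin: "finite L" "finite U"
    unfolding L_def U_def
    by (rule finite_subset[of _ "{..Suc N} \<times> {..N}"]; auto)+
  have LU: "{..Suc N} \<times> {..N} = L \<union> U" "L \<inter> U = {}"
    by (auto simp: L_def U_def)
  \<comment> \<open>The pair \<open>(Suc j, i)\<close> in \<open>L\<close> is matched with
    \<open>(i, j)\<close> in \<open>U\<close>. The values of \<open>g\<close> agree there, while the
    index sums differ by one, so the signs are opposite.\<close>
  have "sum h L = (\<Sum>p\<in>U. - h p)"
  proof (rule sum.reindex_bij_witness[where i = "\<lambda>(i, j). (Suc j, i)" and j = "\<lambda>(j, i). (i, j - 1)"])
    fix p assume "p \<in> L"
    then obtain i j where p: "p = (Suc j, i)" "i \<le> j" "j \<le> N"
      by (cases p; cases "fst p") (auto simp: L_def)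
    then show "- h (case p of (j, i) \<Rightarrow> (i, j - 1)) = h p"
      using assms[of i j] by (simp add: h_def add.commute)
  qed (auto simp: L_def U_def)
  then have "sum h ({..Suc N} \<times> {..N}) = 0"
    using fin LU by (simp add: sum.union_disjoint sum_negf)
  then show ?thesis
    by (simp add: sum.cartesian_product h_def)
qed

section \<open>Contraction of neighbouring arguments\<close>

locale multiplicative_hom_associative_morphism =
  hom_associative_morphism scale mu alpha scale' mu' alpha' phi +
  A: multiplicative_hom_associative_algebra scale mu alpha +
  A': multiplicative_hom_associative_algebra scale' mu' alpha'
  for scale :: "'k::field \<Rightarrow> 'a::ab_group_add \<Rightarrow> 'a"
    and mu alpha
    and scale' :: "'k \<Rightarrow> 'b::ab_group_add \<Rightarrow> 'b"
    and mu' alpha' phi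
begin

text \<open>Positions count from 0, so the \<open>k\<close>-th middle term of the coboundary
  evaluates the cochain at \<open>contract (k - 1) xs\<close>. As an operation on lists alone, it
  lets the identities be checked entry by entry.\<close>

definition contract :: "nat \<Rightarrow> 'a list \<Rightarrow> 'a list" where
  "contract i xs = map alpha (take i xs) @ [mu (xs ! i) (xs ! Suc i)] @ map alpha (drop (i + 2) xs)"

lemma length_contract [simp]: "Suc i < length xs \<Longrightarrow> length (contract i xs) = length xs - 1"
  by (simp add: contract_def)

lemma nth_contract:
  assumes "Suc i < length xs" "m < length xs - 1"
  shows "contract i xs ! m =
    (if m < i then alpha (xs ! m) else if m = i then mu (xs ! i) (xs ! Suc i) else alpha (xs ! Suc m))"
  using assms by (auto simp: contract_def nth_append nth_Cons' intro!: arg_cong[where f = "\<lambda>k. alpha (xs ! k)"])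

text \<open>The inner contraction on the right removes an entry further left, so position
  \<open>Suc j\<close> becomes \<open>j\<close>. Away from the merged entries both sides apply
  \<open>alpha\<close> twice.\<close>

lemma contract_contract:
  assumes "i \<le> j" "Suc (Suc j) < length xs"
  shows "contract i (contract (Suc j) xs) = contract j (contract i xs)"
proof (rule nth_equalityI)
  fix m assume "m < length (contract i (contract (Suc j) xs))"
  then have "m < length xs - 2" using assms by simp
  then show "contract i (contract (Suc j) xs) ! m = contract j (contract i xs) ! m"
    using assms
    by (auto simp: nth_contract A.multiplicative A.hom_associative)
qed (use assms in simp)

lemma map_alpha_contract:
  assumes "Suc i < length xs"
  shows "map alpha (contract i xs) = contract i (map alpha xs)"
  using assms by (auto simp: nth_contract A.multiplicative intro!: nth_equalityI)

lemma drop_contract: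
  assumes "Suc (Suc i) < length xs"
  shows "drop 1 (contract (Suc i) xs) = contract i (drop 1 xs)"
  using assms by (auto simp: nth_contract intro!: nth_equalityI)

lemma take_contract:
  assumes "Suc i < n" "n < length xs"
  shows "take (n - 1) (contract i xs) = contract i (take n xs)"
  using assms by (auto simp: nth_contract intro!: nth_equalityI)

section \<open>Coface maps, without signs, and their cosimplicial identities\<close>

definition coface :: "nat \<Rightarrow> nat \<Rightarrow> ('a list \<Rightarrow> 'b) \<Rightarrow> 'a list \<Rightarrow> 'b" where
  "coface n k f xs =
    (if k = 0 then mu' (phi ((alpha ^^ (n - 1)) (xs ! 0))) (f (drop 1 xs))
     else if k \<le> n then f (contract (k - 1) xs)
     else mu' (f (take n xs)) (phi ((alpha ^^ (n - 1)) (xs ! n))))"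

abbreviation coboundary :: "nat \<Rightarrow> ('a list \<Rightarrow> 'b) \<Rightarrow> 'a list \<Rightarrow> 'b" where
  "coboundary \<equiv> hom_coboundary mu alpha scale' mu' phi"

lemma coboundary_eq_sum_coface:
  assumes "length xs = n + 1"
  shows "coboundary n f xs = (\<Sum>k\<le>Suc n. scale' ((- 1) ^ k) (coface n k f xs))"
proof -
  have "(\<Sum>k\<le>Suc n. scale' ((- 1) ^ k) (coface n k f xs)) =
    coface n 0 f xs + (\<Sum>k = 1..n. scale' ((- 1) ^ k) (coface n k f xs))
      + scale' ((- 1) ^ (n + 1)) (coface n (Suc n) f xs)"
    by (simp add: atMost_atLeast0 sum.atLeast_Suc_atMost)
  moreover have "(\<Sum>k = 1..n. scale' ((- 1) ^ k) (coface n k f xs)) =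
    (\<Sum>k = 1..n. scale' ((- 1) ^ k)
            (f (map alpha (take (k - 1) xs) @ [mu (xs ! (k - 1)) (xs ! k)]
                @ map alpha (drop (k + 1) xs))))"
    by (rule sum.cong) (auto simp: coface_def contract_def)
  ultimately show ?thesis
    using assms by (simp add: hom_coboundary_def left_action_def right_action_def coface_def)
qed

lemma funpow_alpha_mu: "(alpha ^^ m) (mu x y) = mu ((alpha ^^ m) x) ((alpha ^^ m) y)"
  by (induction m) (simp_all add: A.multiplicative)

lemma coface_coface:
  assumes f: "\<And>us. length us = n \<Longrightarrow> alpha' (f us) = f (map alpha us)"
    and n: "n \<ge> 1" and ij: "i \<le> j" "j \<le> Suc n" and len: "length xs = n + 2"
  shows "coface (Suc n) (Suc j) (coface n i f) xs = coface (Suc n) i (coface n j f) xs"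
proof -
  obtain m where m: "n = Suc m" using n by (cases n) auto
  \<comment> \<open>The acting element carries the exponent \<open>m\<close> in degree
    \<open>n\<close> and \<open>Suc m\<close> in degree \<open>n + 1\<close>. The extra
    \<open>alpha\<close> becomes an outer \<open>alpha'\<close>, the form in which Hom-associativity
    of \<open>mu'\<close> applies.\<close>
  have twist: "phi ((alpha ^^ m) (alpha x)) = alpha' (phi ((alpha ^^ m) x))"
    "phi (alpha ((alpha ^^ m) x)) = alpha' (phi ((alpha ^^ m) x))" for x
    by (simp_all flip: funpow_swap1 add: phi_alpha)
  \<comment> \<open>Cases (a) and (f) compare two actions on one side with the action of a product;
    (c) exchanges a left and a right action; (b) and (e) exchange an action with a contraction; (d)
    has two contractions.\<close>
  consider (a) "i = 0" "j = 0" | (b) "i = 0" "0 < j" "j \<le> n" | (c) "i = 0" "j = Suc n"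
    | (d) "0 < i" "j \<le> n" | (e) "0 < i" "i \<le> n" "j = Suc n" | (f) "i = Suc n" "j = Suc n"
    using ij by linarith
  then show ?thesis
  proof cases
    case a
    \<comment> \<open>The cochain condition turns \<open>f (map alpha (drop 2 xs))\<close> into
      \<open>alpha' (f (drop 2 xs))\<close>, the twisted third factor in Hom-associativity of
      \<open>mu'\<close>.\<close>
    have "drop 1 (contract 0 xs) = map alpha (drop 2 xs)"
      by (simp add: contract_def numeral_2_eq_2)
    then show ?thesis
      using a len f[of "drop 2 xs"]
      by (simp add: coface_def m nth_contract funpow_alpha_mu A'.hom_associative twist
          numeral_2_eq_2 flip: phi_mu)
  next
    case b
    then obtain j' where "j = Suc j'" by (cases j) auto
    then show ?thesis
      using b len drop_contract[of j' xs] by (simp add: coface_def m nth_contract twist)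
  next
    case c
    then show ?thesis
      using len by (simp add: coface_def m A'.hom_associative twist drop_take)
  next
    case d
    then obtain i' j' where "i = Suc i'" "j = Suc j'" using ij by (cases i; cases j) auto
    then show ?thesis
      using d ij len by (simp add: coface_def contract_contract)
  next
    case e
    then obtain i' where "i = Suc i'" by (cases i) auto
    then show ?thesis
      using e len take_contract[of i' "Suc n" xs] by (simp add: coface_def m nth_contract twist)
  next
    case f
    have "take n (contract n xs) = map alpha (take n xs)"
      using len by (simp add: contract_def)
    then show ?thesis
      using f len assms(1)[of "take n xs"]
      by (simp add: coface_def m nth_contract funpow_alpha_mu A'.hom_associative[symmetric] twist
          flip: phi_mu)
  qed
qed

text \<open>A coface is linear in the cochain: the two actions by bilinearity of \<open>mu'\<close>,
  a contraction because it only evaluates the cochain at another list.\<close>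

lemma coface_coboundary:
  assumes len: "length xs = n + 2"
  shows "coface (Suc n) k (coboundary n f) xs =
    (\<Sum>i\<le>Suc n. scale' ((- 1) ^ i) (coface (Suc n) k (coface n i f) xs))"
proof -
  interpret l: Vector_Spaces.linear scale' scale' "\<lambda>y. mu' x y" for x
    by (rule A'.mu_linear_right)
  interpret r: Vector_Spaces.linear scale' scale' "\<lambda>x. mu' x y" for y
    by (rule A'.mu_linear_left)
  show ?thesis
    using len by (simp add: coface_def[of "Suc n"] coboundary_eq_sum_coface l.sum l.scale r.sum r.scale
        del: sum.atMost_Suc)
qed

lemma coboundary_coboundary:
  assumes f: "\<And>us. length us = n \<Longrightarrow> alpha' (f us) = f (map alpha us)" and n: "n \<ge> 1"
  shows "coboundary (n + 1) (coboundary n f) = (\<lambda>_. 0)"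
proof
  fix xs
  show "coboundary (n + 1) (coboundary n f) xs = 0"
  proof (cases "length xs = n + 2")
    case True
    then have "coboundary (n + 1) (coboundary n f) xs =
      (\<Sum>j\<le>Suc (Suc n). \<Sum>i\<le>Suc n. scale' ((- 1) ^ (j + i)) (coface (Suc n) j (coface n i f) xs))"
      by (simp add: coboundary_eq_sum_coface coface_coboundary A'.scale_sum_right power_add
          del: sum.atMost_Suc)
    also have "\<dots> = 0"
      using coface_coface[where f = f and n = n, OF f n _ _ True] by (intro A'.sum_alternating_cancel) auto
    finally show ?thesis .
  \<comment> \<open>On lists of any other length the outer coboundary takes its default value
    0.\<close>
  qed (simp add: hom_coboundary_def)
qed

section \<open>The coboundary of a cochain is again a cochain\<close>

lemma alpha'_coface:
  assumes f: "\<And>us. length us = n \<Longrightarrow> alpha' (f us) = f (map alpha us)"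
    and len: "length xs = n + 1"
  shows "alpha' (coface n k f xs) = coface n k f (map alpha xs)"
  using len
  by (auto simp: coface_def A'.multiplicative f map_alpha_contract phi_alpha[symmetric]
      funpow_swap1 drop_map take_map)

lemma alpha'_coboundary:
  assumes f: "\<And>us. length us = n \<Longrightarrow> alpha' (f us) = f (map alpha us)"
    and len: "length xs = n + 1"
  shows "alpha' (coboundary n f xs) = coboundary n f (map alpha xs)"
proof -
  interpret a: Vector_Spaces.linear scale' scale' alpha'
    by (rule A'.alpha_linear)
  show ?thesis
    using len alpha'_coface[where f = f and n = n, OF f]
    by (simp add: coboundary_eq_sum_coface a.sum a.scale del: sum.atMost_Suc)
qed

text \<open>Reduces linearity of a contraction term in one variable to linearity of \<open>f\<close>
  in one slot. \<open>L\<close> is \<open>alpha\<close> for an entry outside the merged pair and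
  multiplication by the other factor for an entry inside it; entries after the pair move down by
  one.\<close>

lemma contract_list_update:
  assumes "Suc c < length xs" "i < length xs"
  obtains m L where "m < length xs - 1" "Vector_Spaces.linear scale scale L"
    "\<And>u. contract c (xs[i := u]) = (contract c xs)[m := L u]"
proof -
  consider "i < c" | "i = c" | "i = Suc c" | "i > Suc c" by linarith
  then show thesis
  proof cases
    case 1
    show ?thesis
      by (rule that[of i alpha]) (use 1 assms A.alpha_linear in
        \<open>auto simp: nth_contract nth_list_update intro!: nth_equalityI\<close>)
  next
    case 2
    show ?thesis
      by (rule that[of c "\<lambda>u. mu u (xs ! Suc c)"]) (use 2 assms A.mu_linear_left in
        \<open>auto simp: nth_contract nth_list_update intro!: nth_equalityI\<close>)
  next
    case 3
    show ?thesis
      by (rule that[of c "\<lambda>u. mu (xs ! c) u"]) (use 3 assms A.mu_linear_right in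
        \<open>auto simp: nth_contract nth_list_update intro!: nth_equalityI\<close>)
  next
    case 4
    show ?thesis
      by (rule that[of "i - 1" alpha]) (use 4 assms A.alpha_linear in
        \<open>auto simp: nth_contract nth_list_update intro!: nth_equalityI\<close>)
  qed
qed

lemma linear_coface:
  assumes f: "f \<in> multilinear_maps scale scale' n"
    and len: "length xs = n + 1" and i: "i < n + 1"
  shows "Vector_Spaces.linear scale scale' (\<lambda>u. coface n k f (xs[i := u]))"
proof -
  note comp = Vector_Spaces.linear_compose[unfolded o_def]
  have lin_f: "Vector_Spaces.linear scale scale' (\<lambda>u. f (us[i := u]))"
    if "length us = n" "i < n" for us i
    using f that by (auto simp: multilinear_maps_def)
  have lin_pow: "Vector_Spaces.linear scale scale (alpha ^^ m)" for m
  proof (induction m)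
    case 0
    then show ?case using A.linear_id by (simp add: id_def)
  next
    case (Suc m)
    then show ?case using Vector_Spaces.linear_compose[OF Suc A.alpha_linear] by (simp add: o_def)
  qed
  have lin_phi: "Vector_Spaces.linear scale scale' (\<lambda>u. phi ((alpha ^^ m) u))" for m
    using comp[OF lin_pow phi_linear] .
  consider "k = 0" | "0 < k" "k \<le> n" | "k > n" by linarith
  then show ?thesis
  proof cases
    case 1
    show ?thesis
    \<comment> \<open>The variable is either the acting element or an argument of \<open>f\<close>;
      in the latter case its index drops by one because the head of the list is removed.\<close>
    proof (cases i)
      case 0
      then show ?thesis
        using 1 len comp[OF lin_phi A'.mu_linear_left] by (simp add: coface_def)
    next
      case (Suc i')
      then show ?thesis
        using 1 len i comp[OF lin_f A'.mu_linear_right, of "drop 1 xs" i']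
        by (simp add: coface_def drop_update_swap)
    qed
  next
    case 2
    obtain m L where "m < n" and L: "Vector_Spaces.linear scale scale L"
      and "\<And>u. contract (k - 1) (xs[i := u]) = (contract (k - 1) xs)[m := L u]"
      using contract_list_update[of "k - 1" xs i] 2 len i by auto
    then show ?thesis
      using 2 len comp[OF L lin_f, of "contract (k - 1) xs" m] by (simp add: coface_def)
  next
    case 3
    show ?thesis
    \<comment> \<open>The same distinction for the right action, where the last entry acts and the
      other indices stay unchanged.\<close>
    proof (cases "i = n")
      case True
      then show ?thesis
        using 3 len comp[OF lin_phi A'.mu_linear_right] by (simp add: coface_def)
    next
      case False
      then show ?thesis
        using 3 len i comp[OF lin_f A'.mu_linear_left, of "take n xs" i]
        by (simp add: coface_def take_update_swap)
    qed
  qed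
qed

lemma coboundary_in_hom_cochains:
  assumes f: "f \<in> hom_cochains scale alpha scale' alpha' n"
  shows "coboundary n f \<in> hom_cochains scale alpha scale' alpha' (n + 1)"
proof -
  interpret P: vector_space_pair scale scale' ..
  have ml: "f \<in> multilinear_maps scale scale' n"
    and eq: "\<And>us. length us = n \<Longrightarrow> alpha' (f us) = f (map alpha us)"
    using f by (auto simp: hom_cochains_def)
  have "Vector_Spaces.linear scale scale' (\<lambda>u. coboundary n f (xs[i := u]))"
    if "length xs = n + 1" "i < n + 1" for xs i
    using that linear_coface[OF ml that]
    by (auto simp: coboundary_eq_sum_coface simp del: sum.atMost_Suc
        intro!: P.linear_compose_sum P.linear_compose_scale_right)
  then have "coboundary n f \<in> multilinear_maps scale scale' (n + 1)"
    by (simp add: multilinear_maps_def hom_coboundary_def)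
  then show ?thesis
    using alpha'_coboundary[where f = f and n = n, OF eq] by (simp add: hom_cochains_def)
qed

end

theorem proposition2p3:
  fixes scale :: "'k::{alg_closed_field, field_char_0} \<Rightarrow> 'a::ab_group_add \<Rightarrow> 'a"
    and mu :: "'a \<Rightarrow> 'a \<Rightarrow> 'a"
    and alpha :: "'a \<Rightarrow> 'a"
    and scale' :: "'k \<Rightarrow> 'b::ab_group_add \<Rightarrow> 'b"
    and mu' :: "'b \<Rightarrow> 'b \<Rightarrow> 'b"
    and alpha' :: "'b \<Rightarrow> 'b"
    and phi :: "'a \<Rightarrow> 'b"
    and n :: nat
  assumes "multiplicative_hom_associative_algebra scale mu alpha"
    and "multiplicative_hom_associative_algebra scale' mu' alpha'"
    and "hom_associative_morphism scale mu alpha scale' mu' alpha' phi"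
    and "n \<ge> 1"
  shows "hom_coboundary mu alpha scale' mu' phi n
           \<in> hom_cochains scale alpha scale' alpha' n \<rightarrow> hom_cochains scale alpha scale' alpha' (n + 1)
       \<and> (\<forall>f \<in> hom_cochains scale alpha scale' alpha' n.
            hom_coboundary mu alpha scale' mu' phi (n + 1)
              (hom_coboundary mu alpha scale' mu' phi n f) = (\<lambda>_. 0))"
proof -
  interpret multiplicative_hom_associative_morphism scale mu alpha scale' mu' alpha' phi
    using assms(1-3) by (simp add: multiplicative_hom_associative_morphism_def)
  show ?thesis
    using coboundary_in_hom_cochains coboundary_coboundary[OF _ assms(4)]
    by (auto simp: hom_cochains_def)
qed

end
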